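(* Let $n$ be an even positive integer and let $b\ge 3$ be an odd integer. Set $k=\left\lfloor\frac{n-2}{b+1}\right\rfloor$ and assume $k\ge 1$. For $1\le s\le k$ let $G_s=K_s\nabla\left(K_{n-(b+1)s-1}\cup(bs+1)K_1\right)$. Then for every $\alpha\in(\frac12,1)$, $$\max_{1\le s\le k}\rho_\alpha(G_s)=\max\{\rho_\alpha(G_1),\rho_\alpha(G_k)\}.$$
   Context: All graphs are simple, finite and undirected. $K_m$ is the complete graph on $m$ vertices, $mK_1$ is the graph with $m$ isolated vertices, $\cup$ is the disjoint union of graphs, and $\nabla$ is the join of two graphs (disjoint union plus all edges between the two). For a graph $G$ with adjacency matrix $A(G)$ and diagonal degree matrix $D(G)$, and $\alpha\in[0,1]$, set $A_\alpha(G)=\alpha D(G)+(1-\alpha)A(G)$, and let $\rho_\alpha(G)$ be the spectral radius of $A_\alpha(G)$. The index $s$ ranges over integers. *)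

theory Defs
  imports "Jordan_Normal_Form.Spectral_Radius"
begin

text \<open>
  A finite simple graph is given by its number of vertices, the vertex set being
  \<open>{0..<nverts G}\<close>, and its set of edges, each a two-element set of vertices. This labelling
  makes the matrices of a graph ordinary \<open>nverts G\<close> by \<open>nverts G\<close> matrices. In a disjoint
  union or join the vertices of the second graph are shifted past those of the first.
\<close>

record sgraph =
  nverts :: nat
  edges :: "nat set set"

definition simple_graph :: "sgraph \<Rightarrow> bool" where
  "simple_graph G \<longleftrightarrow> (\<forall>e \<in> edges G. e \<subseteq> {0..<nverts G} \<and> card e = 2)"

definition complete_graph :: "nat \<Rightarrow> sgraph" where
  "complete_graph m = \<lparr>nverts = m, edges = {{u, v} | u v. u < m \<and> v < m \<and> u \<noteq> v}\<rparr>"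

definition isolated_graph :: "nat \<Rightarrow> sgraph" where
  "isolated_graph m = \<lparr>nverts = m, edges = {}\<rparr>"

definition disjoint_union :: "sgraph \<Rightarrow> sgraph \<Rightarrow> sgraph" where
  "disjoint_union G H =
     \<lparr>nverts = nverts G + nverts H,
      edges = edges G \<union> (\<lambda>e. (\<lambda>v. nverts G + v) ` e) ` edges H\<rparr>"

definition graph_join :: "sgraph \<Rightarrow> sgraph \<Rightarrow> sgraph" where
  "graph_join G H =
     \<lparr>nverts = nverts G + nverts H,
      edges = edges (disjoint_union G H) \<union>
              {{u, nverts G + v} | u v. u < nverts G \<and> v < nverts H}\<rparr>"

lemma simple_graph_complete_graph: "simple_graph (complete_graph m)"
  by (auto simp: simple_graph_def complete_graph_def)

lemma simple_graph_isolated_graph: "simple_graph (isolated_graph m)"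
  by (simp add: simple_graph_def isolated_graph_def)

lemma simple_graph_disjoint_union:
  assumes "simple_graph G" "simple_graph H"
  shows "simple_graph (disjoint_union G H)"
  using assms by (fastforce simp: simple_graph_def disjoint_union_def card_image)

lemma simple_graph_graph_join:
  assumes "simple_graph G" "simple_graph H"
  shows "simple_graph (graph_join G H)"
proof -
  have "\<forall>e \<in> edges (disjoint_union G H). e \<subseteq> {0..<nverts G + nverts H} \<and> card e = 2"
    using simple_graph_disjoint_union[OF assms]
    by (simp add: simple_graph_def disjoint_union_def)
  then show ?thesis
    unfolding simple_graph_def graph_join_def by auto
qed

definition vertex_degree :: "sgraph \<Rightarrow> nat \<Rightarrow> nat" where
  "vertex_degree G v = card {u \<in> {0..<nverts G}. {v, u} \<in> edges G}"

definition adjacency_matrix :: "sgraph \<Rightarrow> real mat" where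
  "adjacency_matrix G =
     mat (nverts G) (nverts G) (\<lambda>(i, j). if {i, j} \<in> edges G then 1 else 0)"

definition degree_matrix :: "sgraph \<Rightarrow> real mat" where
  "degree_matrix G =
     mat (nverts G) (nverts G) (\<lambda>(i, j). if i = j then real (vertex_degree G i) else 0)"

definition A_alpha :: "real \<Rightarrow> sgraph \<Rightarrow> real mat" where
  "A_alpha \<alpha> G = \<alpha> \<cdot>\<^sub>m degree_matrix G + (1 - \<alpha>) \<cdot>\<^sub>m adjacency_matrix G"

definition rho_alpha :: "real \<Rightarrow> sgraph \<Rightarrow> real" where
  "rho_alpha \<alpha> G = spectral_radius (map_mat complex_of_real (A_alpha \<alpha> G))"

text \<open>
  The subtractions below do not truncate as long as \<open>(b + 1) * s + 1 \<le> n\<close>, and then the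
  graph has exactly \<open>n\<close> vertices.
\<close>

definition G_graph :: "nat \<Rightarrow> nat \<Rightarrow> nat \<Rightarrow> sgraph" where
  "G_graph n b s =
     graph_join (complete_graph s)
       (disjoint_union (complete_graph (n - (b + 1) * s - 1)) (isolated_graph (b * s + 1)))"

lemma simple_graph_G_graph: "simple_graph (G_graph n b s)"
  unfolding G_graph_def
  by (intro simple_graph_graph_join simple_graph_disjoint_union
      simple_graph_complete_graph simple_graph_isolated_graph)

lemma nverts_G_graph:
  assumes "(b + 1) * s + 1 \<le> n"
  shows "nverts (G_graph n b s) = n"
  using assms
  by (simp add: G_graph_def graph_join_def disjoint_union_def complete_graph_def
      isolated_graph_def)

end

theory Submission
  imports Defs
begin

text \<open>
  For the partition into the three cells of \<open>K\<^sub>s \<nabla> (K\<^sub>m \<union> tK\<^sub>1)\<close> the largest root of the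
  characteristic polynomial of the quotient matrix is the spectral radius, so \<open>\<rho>\<^sub>\<alpha>(G\<^sub>s) \<le> l\<close> becomes a
  sign condition on a polynomial \<open>p(l, s)\<close>. For fixed \<open>l\<close> this \<open>p\<close> is a cubic in \<open>s\<close>, and its
  leading coefficient equals every third divided difference.

  Take \<open>l\<close> to be the larger value at the two ends \<open>1\<close>, \<open>k\<close> and suppose that an interior \<open>s\<close> exceeds it.
  Then \<open>p\<close> has signs \<open>+, -, +\<close> at \<open>1, s, k\<close>, and it is nonpositive at \<open>l / \<alpha> > k\<close>, which makes
  the leading coefficient negative. If \<open>l \<le> n - 2\<close>, then \<open>p \<le> 0\<close> also at the zero in \<open>[0, 1)\<close> of
  the factor \<open>l - n + 2 + (b + 1 - \<alpha>) s\<close>, which makes the leading coefficient positive. If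
  \<open>l > n - 2\<close>, then \<open>\<rho>\<^sub>\<alpha>(G\<^sub>s) > n - 2\<close> forces \<open>1 - \<alpha>\<close> to be of order \<open>1 / n\<close>, and for
  such \<open>\<alpha>\<close> the leading coefficient is positive.
\<close>

section \<open>Spectral radius of real matrices\<close>

lemma spectral_radius_ge_eigenvalue:
  fixes A :: "real mat"
  assumes A: "A \<in> carrier_mat n n" and "n > 0"
    and v: "v \<in> carrier_vec n" "v \<noteq> 0\<^sub>v n" "A *\<^sub>v v = \<mu> \<cdot>\<^sub>v v"
  shows "\<bar>\<mu>\<bar> \<le> spectral_radius (map_mat complex_of_real A)"
proof -
  have "eigenvalue A \<mu>"
    using A v unfolding eigenvalue_def eigenvector_def by auto
  then have "eigenvalue (map_mat complex_of_real A) (complex_of_real \<mu>)"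
    by (rule of_real_hom.eigenvalue_hom[OF A])
  then have "complex_of_real \<mu> \<in> spectrum (map_mat complex_of_real A)"
    by (simp add: spectrum_def)
  from imageI[OF this, of norm] show ?thesis
    using spectral_radius_mem_max(2)[of "map_mat complex_of_real A" n] A \<open>n > 0\<close> by auto
qed

text \<open>The upper half of the Collatz-Wielandt bound: in the maximum norm weighted by
  \<open>w\<close> the matrix has operator norm at most \<open>r\<close>. One positive test vector
  thus bounds all complex eigenvalues, with no appeal to Perron-Frobenius theory.\<close>

lemma spectral_radius_le_supersolution:
  fixes A :: "real mat" and w :: "nat \<Rightarrow> real"
  assumes A: "A \<in> carrier_mat n n" and "n > 0"
    and nonneg: "\<And>i j. i < n \<Longrightarrow> j < n \<Longrightarrow> A $$ (i, j) \<ge> 0"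
    and pos: "\<And>i. i < n \<Longrightarrow> w i > 0"
    and super: "\<And>i. i < n \<Longrightarrow> (\<Sum>j<n. A $$ (i, j) * w j) \<le> r * w i"
  shows "spectral_radius (map_mat complex_of_real A) \<le> r"
proof -
  let ?C = "map_mat complex_of_real A"
  have C: "?C \<in> carrier_mat n n" using A by auto
  \<comment> \<open>Evaluate an eigenvector equation where the modulus relative to \<open>w\<close> is largest.\<close>
  obtain l where l: "eigenvalue ?C l" "spectral_radius ?C = cmod l"
    using spectral_radius_mem_max(1)[OF C \<open>n > 0\<close>] by (auto simp: spectrum_def)
  then obtain v where v: "v \<in> carrier_vec n" "v \<noteq> 0\<^sub>v n" "?C *\<^sub>v v = l \<cdot>\<^sub>v v"
    using C unfolding eigenvalue_def eigenvector_def by auto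
  define q where "q i = cmod (v $ i) / w i" for i
  have "Max (q ` {..<n}) \<in> q ` {..<n}"
    using \<open>n > 0\<close> by (intro Max_in) auto
  then obtain i where i: "i < n" "q i = Max (q ` {..<n})" by force
  have q_le: "q j \<le> q i" if "j < n" for j
    using that i by simp
  have norm_v: "cmod (v $ j) = q j * w j" if "j < n" for j
    using pos[OF that] by (simp add: q_def)
  have "q i > 0"
  proof (rule ccontr)
    assume "\<not> q i > 0"
    then have "v $ j = 0" if "j < n" for j
      using q_le[OF that] pos[OF that] norm_v[OF that]
      by (metis linorder_not_less mult_le_0_iff norm_le_zero_iff order.trans less_imp_le)
    then have "v = 0\<^sub>v n" using v(1) by auto
    with v(2) show False by simp
  qed
  have "l * v $ i = (?C *\<^sub>v v) $ i"
    using v i by simp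
  also have "\<dots> = (\<Sum>j<n. complex_of_real (A $$ (i, j)) * v $ j)"
    using A v(1) i by (auto simp: scalar_prod_def atLeast0LessThan intro!: sum.cong)
  finally have "cmod l * cmod (v $ i) = cmod (\<Sum>j<n. complex_of_real (A $$ (i, j)) * v $ j)"
    by (metis norm_mult)
  also have "\<dots> \<le> (\<Sum>j<n. A $$ (i, j) * (q i * w j))"
  proof (intro sum_norm_le)
    fix j assume "j \<in> {..<n}"
    then have j: "j < n" by simp
    have "q j * w j \<le> q i * w j"
      using q_le[OF j] pos[OF j] by (simp add: mult_right_mono)
    then show "cmod (complex_of_real (A $$ (i, j)) * v $ j) \<le> A $$ (i, j) * (q i * w j)"
      using nonneg[OF i(1) j] norm_v[OF j] by (simp add: norm_mult mult_left_mono)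
  qed
  also have "\<dots> = q i * (\<Sum>j<n. A $$ (i, j) * w j)"
    by (simp add: sum_distrib_left mult_ac)
  also have "\<dots> \<le> q i * (r * w i)"
    using super[OF i(1)] \<open>q i > 0\<close> by simp
  finally have "cmod l * (q i * w i) \<le> r * (q i * w i)"
    using norm_v[OF i(1)] by (simp add: mult_ac)
  moreover have "q i * w i > 0" using \<open>q i > 0\<close> pos[OF i(1)] by simp
  ultimately show ?thesis using l(2) mult_right_le_imp_le by metis
qed

section \<open>The graph \<open>K\<^sub>s \<nabla> (K\<^sub>m \<union> tK\<^sub>1)\<close>\<close>

text \<open>The three cells are consecutive intervals of indices, of lengths \<open>s\<close>,
  \<open>m\<close> and \<open>t\<close>. With \<open>m\<close> and \<open>t\<close> free, the
  truncated subtraction in \<open>G_graph\<close> stays out of the matrix computations.\<close>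

definition nested_graph :: "nat \<Rightarrow> nat \<Rightarrow> nat \<Rightarrow> sgraph" where
  "nested_graph s m t =
     graph_join (complete_graph s) (disjoint_union (complete_graph m) (isolated_graph t))"

lemma nverts_nested_graph: "nverts (nested_graph s m t) = s + m + t"
  by (simp add: nested_graph_def graph_join_def disjoint_union_def complete_graph_def
      isolated_graph_def)

lemma edge_nested_graph_iff:
  assumes "i < s + m + t" "j < s + m + t"
  shows "{i, j} \<in> edges (nested_graph s m t) \<longleftrightarrow>
    i \<noteq> j \<and> (i < s \<or> j < s \<or> i < s + m \<and> j < s + m)"
proof
  assume "{i, j} \<in> edges (nested_graph s m t)"
  then show "i \<noteq> j \<and> (i < s \<or> j < s \<or> i < s + m \<and> j < s + m)"
    by (auto simp: nested_graph_def graph_join_def disjoint_union_def complete_graph_def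
        isolated_graph_def doubleton_eq_iff)
next
  assume *: "i \<noteq> j \<and> (i < s \<or> j < s \<or> i < s + m \<and> j < s + m)"
  have cross: "{u, v} \<in> edges (nested_graph s m t)" if "u < s" "\<not> v < s" "v < s + m + t" for u v
  proof -
    have "v - s < m + t" "v = s + (v - s)" using that by auto
    then have "\<exists>u' v'. {u, v} = {u', s + v'} \<and> u' < s \<and> v' < m + t"
      using that(1) by metis
    then show ?thesis
      by (auto simp: nested_graph_def graph_join_def disjoint_union_def complete_graph_def
        isolated_graph_def)
  qed
  consider "i < s" "j < s" | "i < s" "\<not> j < s" | "\<not> i < s" "j < s"
    | "\<not> i < s" "\<not> j < s" "i < s + m" "j < s + m"
    using * by blast
  then show "{i, j} \<in> edges (nested_graph s m t)"
  proof cases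
    case 1
    then show ?thesis using *
      by (auto simp: nested_graph_def graph_join_def disjoint_union_def complete_graph_def)
  next
    case 2
    then show ?thesis using cross assms by blast
  next
    case 3
    then show ?thesis using cross[of j i] assms by (simp add: insert_commute)
  next
    case 4
    then have "{i, j} = (\<lambda>v. s + v) ` {i - s, j - s}" "i - s < m" "j - s < m" "i - s \<noteq> j - s"
      using * by auto
    then have "{i, j} \<in> (\<lambda>e. (\<lambda>v. s + v) ` e) ` {{u, v} |u v. u < m \<and> v < m \<and> u \<noteq> v}"
      by blast
    then show ?thesis
      by (auto simp: nested_graph_def graph_join_def disjoint_union_def complete_graph_def)
  qed
qed

lemma vertex_degree_nested_graph:
  assumes "i < s + m + t"
  shows "real (vertex_degree (nested_graph s m t) i) =
    (if i < s then real s + m + t - 1 else if i < s + m then real s + m - 1 else s)"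
proof -
  have "{u \<in> {0..<nverts (nested_graph s m t)}. {i, u} \<in> edges (nested_graph s m t)} =
     (if i < s then {0..<s + m + t} - {i} else if i < s + m then {0..<s + m} - {i} else {0..<s})"
    using assms edge_nested_graph_iff[of i s m t i]
    by (auto simp: nverts_nested_graph edge_nested_graph_iff)
  then show ?thesis
    using assms by (auto simp: vertex_degree_def)
qed

lemma A_alpha_nested_graph_carrier:
  "A_alpha \<alpha> (nested_graph s m t) \<in> carrier_mat (s + m + t) (s + m + t)"
  by (auto simp: A_alpha_def degree_matrix_def adjacency_matrix_def nverts_nested_graph)

lemma A_alpha_nested_graph_entry:
  assumes "i < s + m + t" "j < s + m + t"
  shows "A_alpha \<alpha> (nested_graph s m t) $$ (i, j) =
    (if i = j then \<alpha> * real (vertex_degree (nested_graph s m t) i)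
     else if i < s \<or> j < s \<or> i < s + m \<and> j < s + m then 1 - \<alpha> else 0)"
  using assms edge_nested_graph_iff[OF assms]
  by (auto simp: A_alpha_def degree_matrix_def adjacency_matrix_def nverts_nested_graph)

definition block_vec :: "nat \<Rightarrow> nat \<Rightarrow> real \<Rightarrow> real \<Rightarrow> real \<Rightarrow> nat \<Rightarrow> real" where
  "block_vec s m x y z i = (if i < s then x else if i < s + m then y else z)"

lemma sum_block_vec:
  "(\<Sum>j<s + m + t. block_vec s m x y z j) = s * x + m * y + t * z"
proof -
  have "(\<Sum>j<s + m + t. block_vec s m x y z j) =
    (\<Sum>j\<in>{..<s}. block_vec s m x y z j) + (\<Sum>j\<in>{s..<s+m}. block_vec s m x y z j) +
    (\<Sum>j\<in>{s+m..<s+m+t}. block_vec s m x y z j)"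
    by (metis add.commute atLeast0LessThan le_add1 le_add_same_cancel1 sum.atLeastLessThan_concat zero_le)
  then show ?thesis by (simp add: block_vec_def)
qed

text \<open>The partition into the three cells is equitable, so the matrix maps vectors constant on
  cells to such vectors. The three values on the right are the action of the 3 by 3 quotient matrix
  on (x, y, z).\<close>

lemma A_alpha_nested_graph_row_sum:
  assumes i: "i < s + m + t"
  shows "(\<Sum>j<s + m + t. A_alpha \<alpha> (nested_graph s m t) $$ (i, j) * block_vec s m x y z j) =
    block_vec s m
      ((\<alpha> * (real s + m + t) + (1 - \<alpha>) * s - 1) * x + (1 - \<alpha>) * (m * y + t * z))
      ((\<alpha> * s + m - 1) * y + (1 - \<alpha>) * s * x)
      (\<alpha> * s * z + (1 - \<alpha>) * s * x) i"
proof -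
  let ?d = "real (vertex_degree (nested_graph s m t) i)"
  \<comment> \<open>\<open>?u\<close> puts 0 on the cells not adjacent to row \<open>i\<close>,
    which turns the off-diagonal part into a sum over all indices. The extra term at j = i replaces
    the spurious diagonal summand by the degree term.\<close>
  let ?u = "\<lambda>j. if i < s then block_vec s m x y z j
     else if i < s + m then block_vec s m x y 0 j else block_vec s m x 0 0 j"
  have "(\<Sum>j<s + m + t. A_alpha \<alpha> (nested_graph s m t) $$ (i, j) * block_vec s m x y z j) =
     (\<Sum>j<s + m + t. (1 - \<alpha>) * ?u j
        + (if j = i then \<alpha> * ?d * block_vec s m x y z i - (1 - \<alpha>) * ?u i else 0))"
    using i by (intro sum.cong refl) (auto simp: A_alpha_nested_graph_entry block_vec_def)
  also have "\<dots> = (1 - \<alpha>) * (\<Sum>j<s + m + t. ?u j)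
      + (\<alpha> * ?d * block_vec s m x y z i - (1 - \<alpha>) * ?u i)"
    using i by (simp add: sum.distrib sum_distrib_left)
  also have "(\<Sum>j<s + m + t. ?u j) = s * x + (if i < s + m then m * y else 0)
      + (if i < s then t * z else 0)"
    by (simp add: sum_block_vec)
  also have "(1 - \<alpha>) * (s * x + (if i < s + m then m * y else 0) + (if i < s then t * z else 0))
      + (\<alpha> * ?d * block_vec s m x y z i - (1 - \<alpha>) * ?u i) = block_vec s m
      ((\<alpha> * (real s + m + t) + (1 - \<alpha>) * s - 1) * x + (1 - \<alpha>) * (m * y + t * z))
      ((\<alpha> * s + m - 1) * y + (1 - \<alpha>) * s * x)
      (\<alpha> * s * z + (1 - \<alpha>) * s * x) i"
    using i by (simp add: vertex_degree_nested_graph block_vec_def algebra_simps)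
  finally show ?thesis .
qed

section \<open>The characteristic polynomial of the quotient matrix\<close>

text \<open>This is det(x I - Q) for the quotient matrix Q, expanded with the help of the two zero
  entries of Q between the clique cell and the isolated cell.\<close>

definition quot_poly :: "real \<Rightarrow> real \<Rightarrow> real \<Rightarrow> real \<Rightarrow> real \<Rightarrow> real" where
  "quot_poly \<alpha> s m t x =
     (x - \<alpha> * (s + m + t) - (1 - \<alpha>) * s + 1) * (x - \<alpha> * s - m + 1) * (x - \<alpha> * s)
     - (1 - \<alpha>)\<^sup>2 * s * (m * (x - \<alpha> * s) + t * (x - \<alpha> * s - m + 1))"

lemma sum_divide_common_denominator:
  fixes a c d m s t :: real
  assumes "c > 0" "d > 0"
  shows "a * (m * (a * s / c) + t * (a * s / d)) = a\<^sup>2 * s * (m * d + t * c) / (c * d)"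
  using assms by (simp add: field_simps power2_eq_square)

text \<open>With value 1 on the first cell, \<open>?y\<close> and \<open>?z\<close> solve the other
  two rows of the eigenvector equation for \<open>x\<close> exactly. The first row then becomes an
  inequality, which after multiplication by \<open>?D1 * ?D2\<close> says that
  \<open>quot_poly\<close> is nonnegative.\<close>

lemma rho_alpha_le:
  fixes s m t :: nat and \<alpha> x :: real
  assumes "s > 0" "0 < \<alpha>" "\<alpha> < 1"
    and D1: "x - \<alpha> * s - m + 1 > 0" and D2: "x - \<alpha> * s > 0"
    and P: "quot_poly \<alpha> s m t x \<ge> 0"
  shows "rho_alpha \<alpha> (nested_graph s m t) \<le> x"
  unfolding rho_alpha_def
proof (rule spectral_radius_le_supersolution[OF A_alpha_nested_graph_carrier])
  let ?D1 = "x - \<alpha> * s - m + 1" and ?D2 = "x - \<alpha> * s"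
  let ?y = "(1 - \<alpha>) * s / ?D1" and ?z = "(1 - \<alpha>) * s / ?D2"
  show "0 < s + m + t" using \<open>s > 0\<close> by simp
  show "0 \<le> A_alpha \<alpha> (nested_graph s m t) $$ (i, j)" if "i < s + m + t" "j < s + m + t" for i j
    using that assms by (simp add: A_alpha_nested_graph_entry)
  show "0 < block_vec s m 1 ?y ?z i" for i
    using assms by (simp add: block_vec_def)
  have y: "(\<alpha> * s + m - 1) * ?y + (1 - \<alpha>) * s * 1 = x * ?y"
    using D1 by (simp add: field_simps)
  have z: "\<alpha> * s * ?z + (1 - \<alpha>) * s * 1 = x * ?z"
    using D2 by (simp add: field_simps)
  have "(1 - \<alpha>) * (m * ?y + t * ?z) = (1 - \<alpha>)\<^sup>2 * s * (m * ?D2 + t * ?D1) / (?D1 * ?D2)"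
    by (rule sum_divide_common_denominator[OF D1 D2])
  also have "\<dots> \<le> x - \<alpha> * (real s + m + t) - (1 - \<alpha>) * s + 1"
    using P D1 D2 by (subst pos_divide_le_eq) (auto simp: quot_poly_def mult_ac)
  finally have x: "(\<alpha> * (real s + m + t) + (1 - \<alpha>) * s - 1) * 1 + (1 - \<alpha>) * (m * ?y + t * ?z) \<le> x * 1"
    by simp
  show "(\<Sum>j<s + m + t. A_alpha \<alpha> (nested_graph s m t) $$ (i, j) * block_vec s m 1 ?y ?z j)
      \<le> x * block_vec s m 1 ?y ?z i" if "i < s + m + t" for i
    unfolding A_alpha_nested_graph_row_sum[OF that] using x y z by (simp add: block_vec_def)
qed

text \<open>The same test vector solves the first row with equality at a root, so it is a genuine
  eigenvector.\<close>

lemma quot_poly_root_le_rho_alpha: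
  fixes s m t :: nat and \<alpha> x :: real
  assumes "s > 0" and D1: "x - \<alpha> * s - m + 1 > 0" and D2: "x - \<alpha> * s > 0"
    and P: "quot_poly \<alpha> s m t x = 0"
  shows "x \<le> rho_alpha \<alpha> (nested_graph s m t)"
proof -
  let ?n = "s + m + t" and ?A = "A_alpha \<alpha> (nested_graph s m t)"
  let ?D1 = "x - \<alpha> * s - m + 1" and ?D2 = "x - \<alpha> * s"
  let ?y = "(1 - \<alpha>) * s / ?D1" and ?z = "(1 - \<alpha>) * s / ?D2"
  define v where "v = vec ?n (block_vec s m 1 ?y ?z)"
  have y: "(\<alpha> * s + m - 1) * ?y + (1 - \<alpha>) * s * 1 = x * ?y"
    using D1 by (simp add: field_simps)
  have z: "\<alpha> * s * ?z + (1 - \<alpha>) * s * 1 = x * ?z"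
    using D2 by (simp add: field_simps)
  have "(1 - \<alpha>) * (m * ?y + t * ?z) = (1 - \<alpha>)\<^sup>2 * s * (m * ?D2 + t * ?D1) / (?D1 * ?D2)"
    by (rule sum_divide_common_denominator[OF D1 D2])
  also have "\<dots> = x - \<alpha> * (real s + m + t) - (1 - \<alpha>) * s + 1"
    using P D1 D2 by (subst nonzero_divide_eq_eq) (auto simp: quot_poly_def mult_ac)
  finally have x: "(\<alpha> * (real s + m + t) + (1 - \<alpha>) * s - 1) * 1 + (1 - \<alpha>) * (m * ?y + t * ?z) = x * 1"
    by simp
  have "?A *\<^sub>v v = x \<cdot>\<^sub>v v"
  proof (rule eq_vecI)
    fix i assume "i < dim_vec (x \<cdot>\<^sub>v v)"
    then have i: "i < ?n" by (simp add: v_def)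
    then have "(?A *\<^sub>v v) $ i = (\<Sum>j<?n. ?A $$ (i, j) * block_vec s m 1 ?y ?z j)"
      using A_alpha_nested_graph_carrier[of \<alpha> s m t]
      by (auto simp: scalar_prod_def atLeast0LessThan v_def intro!: sum.cong)
    also have "\<dots> = (x \<cdot>\<^sub>v v) $ i"
      unfolding A_alpha_nested_graph_row_sum[OF i] using x y z i by (simp add: block_vec_def v_def)
    finally show "(?A *\<^sub>v v) $ i = (x \<cdot>\<^sub>v v) $ i" .
  qed (use A_alpha_nested_graph_carrier[of \<alpha> s m t] in \<open>auto simp: v_def\<close>)
  moreover have "v $ 0 = 1" using \<open>s > 0\<close> by (simp add: v_def block_vec_def)
  then have "v \<noteq> 0\<^sub>v ?n" using \<open>s > 0\<close> by auto
  moreover have "v \<in> carrier_vec ?n" by (simp add: v_def)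
  ultimately have "\<bar>x\<bar> \<le> rho_alpha \<alpha> (nested_graph s m t)"
    unfolding rho_alpha_def using \<open>s > 0\<close>
    by (intro spectral_radius_ge_eigenvalue[OF A_alpha_nested_graph_carrier]) auto
  then show ?thesis by simp
qed

text \<open>The polynomial is monic of degree 3 in its last argument, so a negative value forces a
  root further right, and that root is an eigenvalue. The first factor may vanish at
  \<open>x\<close>, since it is positive at the root; this boundary case is used later.\<close>

lemma rho_alpha_greater:
  fixes s m t :: nat and \<alpha> x :: real
  assumes "s > 0"
    and D1: "x - \<alpha> * s - m + 1 \<ge> 0" and D2: "x - \<alpha> * s > 0"
    and P: "quot_poly \<alpha> s m t x < 0"
  shows "x < rho_alpha \<alpha> (nested_graph s m t)"
proof -
  \<comment> \<open>\<open>X\<close> is an explicit point with nonnegative value: there the last two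
    factors are at least 1, so the subtracted term is at most \<open>N\<close> times their product,
    and the first factor is at least \<open>N\<close>.\<close>
  define N where "N = (1 - \<alpha>)\<^sup>2 * s * (m + t)"
  define X where "X = x + 1 + \<bar>\<alpha> * (real s + m + t) + (1 - \<alpha>) * s - 1 - x\<bar> + N"
  have N: "N \<ge> 0" by (simp add: N_def)
  have X: "X \<ge> x + 1" "X - \<alpha> * (real s + m + t) - (1 - \<alpha>) * s + 1 \<ge> N"
    using N unfolding X_def by linarith+
  have D: "X - \<alpha> * s - m + 1 \<ge> 1" "X - \<alpha> * s \<ge> 1" using X D1 D2 by auto
  have "(1 - \<alpha>)\<^sup>2 * s * (m * (X - \<alpha> * s) + t * (X - \<alpha> * s - m + 1))
    \<le> (1 - \<alpha>)\<^sup>2 * s * (m * ((X - \<alpha> * s - m + 1) * (X - \<alpha> * s))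
       + t * ((X - \<alpha> * s - m + 1) * (X - \<alpha> * s)))"
    using D by (intro mult_left_mono add_mono)
      (auto simp: mult_le_cancel_left1 mult_le_cancel_right1)
  also have "\<dots> = N * ((X - \<alpha> * s - m + 1) * (X - \<alpha> * s))"
    by (simp add: N_def algebra_simps)
  also have "\<dots> \<le> (X - \<alpha> * (real s + m + t) - (1 - \<alpha>) * s + 1)
      * ((X - \<alpha> * s - m + 1) * (X - \<alpha> * s))"
    using X D by (intro mult_right_mono) auto
  finally have "quot_poly \<alpha> s m t X \<ge> 0"
    by (simp add: quot_poly_def mult.assoc)
  moreover have "continuous_on {x..X} (quot_poly \<alpha> s m t)"
    unfolding quot_poly_def by (intro continuous_intros)
  ultimately obtain u where u: "x \<le> u" "quot_poly \<alpha> s m t u = 0"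
    using IVT'[of "quot_poly \<alpha> s m t" x 0 X] P X(1) by auto
  then have "x < u" using P by (cases "x = u") auto
  moreover have "u \<le> rho_alpha \<alpha> (nested_graph s m t)"
    using \<open>x < u\<close> D1 D2 u by (intro quot_poly_root_le_rho_alpha \<open>s > 0\<close>) auto
  ultimately show ?thesis by simp
qed

section \<open>Sign patterns of the quotient polynomial as a cubic in \<open>s\<close>\<close>

text \<open>
  In the proof, \<open>q\<close> and \<open>r\<close> are the first and second divided differences of the cubic.
\<close>

lemma cubic_signs:
  fixes a0 a1 a2 a3 x0 x1 x2 x3 :: real
  defines "p \<equiv> \<lambda>x. a3 * x^3 + a2 * x\<^sup>2 + a1 * x + a0"
  assumes "x0 < x1" "x1 < x2" "x2 < x3"
  shows "p x0 \<le> 0 \<Longrightarrow> p x1 \<ge> 0 \<Longrightarrow> p x2 < 0 \<Longrightarrow> p x3 \<ge> 0 \<Longrightarrow> a3 > 0"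
    and "p x0 \<ge> 0 \<Longrightarrow> p x1 < 0 \<Longrightarrow> p x2 \<ge> 0 \<Longrightarrow> p x3 \<le> 0 \<Longrightarrow> a3 < 0"
proof -
  define q where "q x y = a3 * (x\<^sup>2 + x * y + y\<^sup>2) + a2 * (x + y) + a1" for x y
  define r where "r x y z = a3 * (x + y + z) + a2" for x y z
  have pq: "p y - p x = (y - x) * q x y" for x y
    by (simp add: p_def q_def power2_eq_square power3_eq_cube algebra_simps)
  have qr: "q y z - q x y = (z - x) * r x y z" for x y z
    by (simp add: q_def r_def power2_eq_square algebra_simps)
  have ra: "r x1 x2 x3 - r x0 x1 x2 = (x3 - x0) * a3"
    by (simp add: r_def algebra_simps)
  show "a3 > 0" if "p x0 \<le> 0" "p x1 \<ge> 0" "p x2 < 0" "p x3 \<ge> 0"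
  proof -
    have "q x0 x1 \<ge> 0" "q x1 x2 < 0" "q x2 x3 > 0"
      using pq[of x1 x0] pq[of x2 x1] pq[of x3 x2] that assms(2-4)
      by (smt (verit) zero_less_mult_iff mult_neg_pos mult_pos_neg mult_nonneg_nonneg)+
    then have "r x0 x1 x2 < 0" "r x1 x2 x3 > 0"
      using qr[of x1 x2 x0] qr[of x2 x3 x1] assms(2-4)
      by (smt (verit) zero_less_mult_iff mult_neg_pos mult_pos_neg mult_nonneg_nonneg)+
    then show ?thesis
      using ra assms(2-4) by (smt (verit) zero_less_mult_iff mult_nonneg_nonpos)
  qed
  show "a3 < 0" if "p x0 \<ge> 0" "p x1 < 0" "p x2 \<ge> 0" "p x3 \<le> 0"
  proof -
    have "q x0 x1 < 0" "q x1 x2 > 0" "q x2 x3 \<le> 0"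
      using pq[of x1 x0] pq[of x2 x1] pq[of x3 x2] that assms(2-4)
      by (smt (verit) zero_less_mult_iff mult_neg_pos mult_pos_neg mult_nonneg_nonneg)+
    then have "r x0 x1 x2 > 0" "r x1 x2 x3 < 0"
      using qr[of x1 x2 x0] qr[of x2 x3 x1] assms(2-4)
      by (smt (verit) zero_less_mult_iff mult_neg_pos mult_pos_neg mult_nonneg_nonneg)+
    then show ?thesis
      using ra assms(2-4) by (smt (verit) zero_less_mult_iff mult_nonneg_nonneg)
  qed
qed

text \<open>Here \<open>x\<close> takes the place of the graph parameter and ranges over the reals,
  so that signs can also be read off at points that belong to no graph.\<close>

definition family_poly :: "real \<Rightarrow> real \<Rightarrow> real \<Rightarrow> real \<Rightarrow> real \<Rightarrow> real" where
  "family_poly \<alpha> n b l x = quot_poly \<alpha> x (n - (b + 1) * x - 1) (b * x + 1) l"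

lemma family_poly_factored:
  "family_poly \<alpha> n b l x =
    (l - \<alpha> * n + 1 - (1 - \<alpha>) * x) * (l - n + 2 + (b + 1 - \<alpha>) * x) * (l - \<alpha> * x)
    - (1 - \<alpha>)\<^sup>2 * x * ((n - (b + 1) * x - 1) * (l - \<alpha> * x)
        + (b * x + 1) * (l - n + 2 + (b + 1 - \<alpha>) * x))"
  unfolding family_poly_def quot_poly_def by (simp add: algebra_simps)

text \<open>The coefficient of the cube of \<open>x\<close> in \<open>family_poly\<close>. It
  depends on neither \<open>n\<close> nor \<open>l\<close>, so its sign may be determined at one
  value of \<open>l\<close> and used at another.\<close>

definition family_lead :: "real \<Rightarrow> real \<Rightarrow> real" where
  "family_lead \<alpha> b =
     (1 - \<alpha>) * (\<alpha> * (b + 1 - \<alpha>) - (1 - \<alpha>) * (\<alpha> * (b + 1) + b * (b + 1 - \<alpha>)))"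

lemma family_poly_cubic:
  "\<exists>a2 a1 a0. \<forall>x. family_poly \<alpha> n b l x = family_lead \<alpha> b * x^3 + a2 * x\<^sup>2 + a1 * x + a0"
proof -
  define A d c \<beta> where "A = l - \<alpha> * n + 1" "d = l - n + 2" "c = b + 1 - \<alpha>" "\<beta> = 1 - \<alpha>"
  note defs = this
  have "family_poly \<alpha> n b l x = family_lead \<alpha> b * x^3
      + (\<alpha> * \<beta> * d - \<alpha> * A * c - \<beta> * c * l - \<beta>\<^sup>2 * (b * d + c - (n - 1) * \<alpha> - (b + 1) * l)) * x\<^sup>2
      + (A * c * l - A * d * \<alpha> - \<beta> * d * l - \<beta>\<^sup>2 * ((n - 1) * l + d)) * x + A * d * l" for x
    unfolding family_poly_factored family_lead_def defs[symmetric]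
    by (simp add: power2_eq_square power3_eq_cube algebra_simps)
  then show ?thesis by blast
qed

lemma family_poly_signs:
  fixes \<alpha> n b l :: real
  assumes "x0 < x1" "x1 < x2" "x2 < x3"
  shows "family_poly \<alpha> n b l x0 \<le> 0 \<Longrightarrow> family_poly \<alpha> n b l x1 \<ge> 0 \<Longrightarrow>
      family_poly \<alpha> n b l x2 < 0 \<Longrightarrow> family_poly \<alpha> n b l x3 \<ge> 0 \<Longrightarrow> family_lead \<alpha> b > 0"
    and "family_poly \<alpha> n b l x0 \<ge> 0 \<Longrightarrow> family_poly \<alpha> n b l x1 < 0 \<Longrightarrow>
      family_poly \<alpha> n b l x2 \<ge> 0 \<Longrightarrow> family_poly \<alpha> n b l x3 \<le> 0 \<Longrightarrow> family_lead \<alpha> b < 0"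
proof -
  obtain a2 a1 a0 where
    "\<And>x. family_poly \<alpha> n b l x = family_lead \<alpha> b * x^3 + a2 * x\<^sup>2 + a1 * x + a0"
    using family_poly_cubic by blast
  then show "family_poly \<alpha> n b l x0 \<le> 0 \<Longrightarrow> family_poly \<alpha> n b l x1 \<ge> 0 \<Longrightarrow>
      family_poly \<alpha> n b l x2 < 0 \<Longrightarrow> family_poly \<alpha> n b l x3 \<ge> 0 \<Longrightarrow> family_lead \<alpha> b > 0"
    and "family_poly \<alpha> n b l x0 \<ge> 0 \<Longrightarrow> family_poly \<alpha> n b l x1 < 0 \<Longrightarrow>
      family_poly \<alpha> n b l x2 \<ge> 0 \<Longrightarrow> family_poly \<alpha> n b l x3 \<le> 0 \<Longrightarrow> family_lead \<alpha> b < 0"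
    using cubic_signs[OF assms, of "family_lead \<alpha> b" a2 a1 a0] by simp_all
qed

text \<open>At this point the factor \<open>l - \<alpha> * x\<close> vanishes, and a single term
  with a negative sign remains.\<close>

lemma family_poly_end_le:
  fixes \<alpha> n b l :: real
  assumes "0 < \<alpha>" "\<alpha> < 1" "0 < l" "0 < b" "l - n + 2 + (b + 1 - \<alpha>) * (l / \<alpha>) \<ge> 0"
  shows "family_poly \<alpha> n b l (l / \<alpha>) \<le> 0"
proof -
  have "(1 - \<alpha>)\<^sup>2 * (l / \<alpha>) * ((b * (l / \<alpha>) + 1) * (l - n + 2 + (b + 1 - \<alpha>) * (l / \<alpha>))) \<ge> 0"
    using assms by (intro mult_nonneg_nonneg) auto
  then show ?thesis using assms unfolding family_poly_factored by simp
qed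

text \<open>At l = n - 2 the middle factor is (b + \<beta>) s, which is at most \<open>D2\<close>.
  Replacing it by \<open>D2\<close> in the subtracted term merges the two cell sizes into n - s, and
  cancelling s \<open>D2\<close> leaves an upper bound on \<beta>. For such small \<beta> the term
  \<alpha> (b + \<beta>) dominates the leading coefficient.\<close>

lemma family_lead_pos:
  fixes \<alpha> n b s :: real
  assumes \<alpha>: "1 / 2 < \<alpha>" "\<alpha> < 1" and b: "b \<ge> 3" and s: "s \<ge> 2" "(b + 1) * (s + 1) + 2 \<le> n"
    and P: "family_poly \<alpha> n b (n - 2) s < 0"
  shows "family_lead \<alpha> b > 0"
proof -
  define \<beta> where "\<beta> = 1 - \<alpha>"
  define D2 where "D2 = n - 2 - \<alpha> * s"
  have \<alpha>_eq: "\<alpha> = 1 - \<beta>" and \<beta>: "0 < \<beta>" "\<beta> < 1 / 2" using \<alpha> by (auto simp: \<beta>_def)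
  have ns: "n \<ge> b * s + b + s + 3" using s by (simp add: algebra_simps)
  have D2_ge: "D2 \<ge> (b + \<beta>) * s"
    using ns b by (simp add: D2_def \<alpha>_eq algebra_simps)
  moreover have "(b + \<beta>) * s > 0" using b \<beta> s by simp
  ultimately have "D2 > 0" by linarith
  have "(\<beta> * (n - s) - 1) * ((b + \<beta>) * s) * D2
      < \<beta>\<^sup>2 * s * ((n - (b + 1) * s - 1) * D2 + (b * s + 1) * ((b + \<beta>) * s))"
    using P unfolding family_poly_factored by (simp add: D2_def \<alpha>_eq algebra_simps)
  also have "\<dots> \<le> \<beta>\<^sup>2 * s * ((n - (b + 1) * s - 1) * D2 + (b * s + 1) * D2)"
    using D2_ge b s \<beta> by (intro mult_left_mono add_left_mono) auto
  also have "\<dots> = \<beta>\<^sup>2 * (n - s) * (s * D2)"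
    by (simp add: algebra_simps)
  finally have "(\<beta> * (n - s) - 1) * (b + \<beta>) * (s * D2) < \<beta>\<^sup>2 * (n - s) * (s * D2)"
    by (simp add: mult_ac)
  then have "(\<beta> * (n - s) - 1) * (b + \<beta>) < \<beta>\<^sup>2 * (n - s)"
    using \<open>D2 > 0\<close> s by (simp add: mult_less_cancel_right_pos)
  then have main: "\<beta> * (n - s) * b < b + \<beta>"
    by (simp add: algebra_simps power2_eq_square)
  have "3 * b + 3 \<le> n - s"
  proof -
    have "b * 2 \<le> b * s" using b s by (intro mult_left_mono) auto
    then show ?thesis using ns by linarith
  qed
  then have "\<beta> * (3 * b + 3) * b \<le> \<beta> * (n - s) * b"
    using \<beta> b by (intro mult_right_mono mult_left_mono) auto
  with main have "\<beta> * (3 * b + 3) * b < b + \<beta>" by linarith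
  \<comment> \<open>From \<beta> < 1/2 and b \<ge> 3 follows \<beta> \<le> b/6.\<close>
  also have "\<dots> \<le> 7 / 6 * b" using \<beta> b by simp
  finally have "18 * (\<beta> * (b + 1)) * b < 7 * b" by (simp add: algebra_simps)
  then have small: "\<beta> * (b + 1) < 7 / 18" using b by (simp add: mult_less_cancel_right_pos)
  have "\<beta> * 4 \<le> \<beta> * (b + 1)" using \<beta> b by (intro mult_left_mono) auto
  then have \<beta>_small: "\<beta> < 1 / 10" using small by linarith
  \<comment> \<open>The three estimates suffice because (9/10 - 7/18) (b + \<beta>) exceeds 7/18
    when b \<ge> 3.\<close>
  have "\<alpha> * (\<beta> * (b + 1)) \<le> 1 * (7 / 18)"
    using small \<alpha> \<beta> b by (intro mult_mono) auto
  moreover have "\<beta> * b * (b + \<beta>) \<le> 7 / 18 * (b + \<beta>)"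
    using small \<beta> b by (intro mult_right_mono) (auto simp: algebra_simps)
  moreover have "9 / 10 * (b + \<beta>) \<le> \<alpha> * (b + \<beta>)"
    using \<beta>_small \<beta> b by (intro mult_right_mono) (auto simp: \<alpha>_eq)
  ultimately have "\<alpha> * (b + \<beta>) - \<beta> * (\<alpha> * (b + 1) + b * (b + \<beta>)) > 0"
    using b \<beta> by (simp add: algebra_simps)
  moreover have "b + 1 - \<alpha> = b + \<beta>" "1 - \<alpha> = \<beta>" by (auto simp: \<beta>_def)
  ultimately show ?thesis
    unfolding family_lead_def using \<beta> by (simp only: mult_pos_pos)
qed

section \<open>The sign criterion for the graphs G_s\<close>

lemma G_graph_eq_nested:
  "G_graph n b s = nested_graph s (n - (b + 1) * s - 1) (b * s + 1)"
  by (simp add: G_graph_def nested_graph_def)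

lemma quot_poly_G_graph:
  fixes n b s :: nat and \<alpha> l :: real
  assumes "(b + 1) * s + 1 \<le> n"
  shows "quot_poly \<alpha> (real s) (real (n - (b + 1) * s - 1)) (real (b * s + 1)) l =
      family_poly \<alpha> n b l s"
    and "l - \<alpha> * s - real (n - (b + 1) * s - 1) + 1 = l - real n + 2 + (real b + 1 - \<alpha>) * s"
proof -
  have m: "real (n - (b + 1) * s - 1) = n - (real b + 1) * s - 1"
  proof -
    have "real n = real ((n - (b + 1) * s - 1) + ((b + 1) * s + 1))" using assms by simp
    then show ?thesis unfolding of_nat_add by (simp add: algebra_simps)
  qed
  show "quot_poly \<alpha> (real s) (real (n - (b + 1) * s - 1)) (real (b * s + 1)) l =
      family_poly \<alpha> n b l s"
    unfolding m family_poly_def by (simp add: add.commute)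
  show "l - \<alpha> * s - real (n - (b + 1) * s - 1) + 1 = l - real n + 2 + (real b + 1 - \<alpha>) * s"
    unfolding m by (simp add: algebra_simps)
qed

lemma rho_alpha_G_graph_le:
  fixes n b s :: nat and \<alpha> l :: real
  assumes "s > 0" "0 < \<alpha>" "\<alpha> < 1" "(b + 1) * s + 1 \<le> n"
    and "l - real n + 2 + (real b + 1 - \<alpha>) * s > 0" "l - \<alpha> * s > 0" "family_poly \<alpha> n b l s \<ge> 0"
  shows "rho_alpha \<alpha> (G_graph n b s) \<le> l"
  unfolding G_graph_eq_nested using assms
  by (intro rho_alpha_le) (simp_all only: quot_poly_G_graph)

lemma rho_alpha_G_graph_greater:
  fixes n b s :: nat and \<alpha> l :: real
  assumes "s > 0" "(b + 1) * s + 1 \<le> n"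
    and "l - real n + 2 + (real b + 1 - \<alpha>) * s \<ge> 0" "l - \<alpha> * s > 0" "family_poly \<alpha> n b l s < 0"
  shows "l < rho_alpha \<alpha> (G_graph n b s)"
  unfolding G_graph_eq_nested using assms
  by (intro rho_alpha_greater) (simp_all only: quot_poly_G_graph)

section \<open>Comparison of an interior index with the two ends\<close>

lemma rho_alpha_G_graph_le_ends:
  fixes n b k s :: nat and \<alpha> :: real
  assumes b: "b \<ge> 3" and n: "(b + 1) * k + 2 \<le> n" and s: "1 < s" "s < k"
    and \<alpha>: "1 / 2 < \<alpha>" "\<alpha> < 1"
  shows "rho_alpha \<alpha> (G_graph n b s) \<le>
    max (rho_alpha \<alpha> (G_graph n b 1)) (rho_alpha \<alpha> (G_graph n b k))"
proof (rule ccontr)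
  define l where "l = max (rho_alpha \<alpha> (G_graph n b 1)) (rho_alpha \<alpha> (G_graph n b k))"
  define c where "c = real b + 1 - \<alpha>"
  let ?p = "family_poly \<alpha> n b l"
  assume "\<not> ?thesis"
  then have gt: "rho_alpha \<alpha> (G_graph n b s) > l" by (simp only: l_def not_le)
  have nr: "(real b + 1) * k + 2 \<le> n"
    using of_nat_mono[OF n, where 'a = real] by (simp add: algebra_simps)
  have c: "c > real b" "c < real b + 1" "c > 0" using \<alpha> b by (auto simp: c_def)
  have room: "(b + 1) * j + 1 \<le> n" if "j \<le> k" for j
    using mult_le_mono2[OF that, of "b + 1"] n by linarith
  have bk: "real b * 3 \<le> real b * k" "3 * real k \<le> real b * k" "real k \<ge> 3" "real b \<ge> 3"
    using b s by (auto intro: mult_left_mono mult_right_mono)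
  have n_big: "real n \<ge> real b * k + k + 2" using nr by (simp add: algebra_simps)
  have m_pos: "real n - (real b + 1) * 1 - 1 > 0"
    unfolding mult_1_right using n_big bk by argo
  \<comment> \<open>\<open>?l0\<close> is the zero of the middle factor at index 1, where the
    polynomial reduces to a negative term. The resulting bound makes that factor positive for all x
    \<ge> 1, as the sign criterion requires.\<close>
  have l_gt: "l > real n - 2 - c"
  proof -
    let ?l0 = "real n - 2 - c"
    have D2: "?l0 - \<alpha> * 1 > 0" using n_big bk c \<alpha> b s by linarith
    have "(1 - \<alpha>)\<^sup>2 * 1 * ((real n - (real b + 1) * 1 - 1) * (?l0 - \<alpha> * 1)) > 0"
      using D2 m_pos \<alpha> by (intro mult_pos_pos) auto
    then have "family_poly \<alpha> n b ?l0 1 < 0"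
      unfolding family_poly_factored c_def[symmetric] by simp
    then have "?l0 < rho_alpha \<alpha> (G_graph n b 1)"
      using rho_alpha_G_graph_greater[of 1 b n ?l0 \<alpha>] room[of 1] s D2
      by (simp add: c_def)
    then show ?thesis by (simp add: l_def)
  qed
  have D1: "l - real n + 2 + c * x > 0" if "x \<ge> 1" for x :: real
  proof -
    have "c * 1 \<le> c * x" using that c by (intro mult_left_mono) auto
    then show ?thesis using l_gt by simp
  qed
  have "l > k" using l_gt n_big bk c by linarith
  have D2: "l - \<alpha> * x > 0" if "x \<le> k" for x :: real
  proof -
    have "\<alpha> * x \<le> \<alpha> * k" "\<alpha> * k \<le> 1 * real k"
      using that \<alpha> by (intro mult_left_mono mult_right_mono; simp)+
    then show ?thesis using \<open>l > k\<close> by linarith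
  qed
  have "l / \<alpha> > k" using D2[of "real k"] \<alpha> by (simp add: field_simps)
  then have "?p (l / \<alpha>) \<le> 0"
    using D1[of "l / \<alpha>"] \<alpha> b s \<open>l > k\<close> by (intro family_poly_end_le) (auto simp: c_def)
  have ends: "?p j \<ge> 0" if "j = 1 \<or> j = k" for j :: nat
  proof (rule ccontr)
    assume "\<not> ?p j \<ge> 0"
    then have "l < rho_alpha \<alpha> (G_graph n b j)"
      using that room[of j] D1[of "real j"] D2[of "real j"] s
      by (intro rho_alpha_G_graph_greater) (auto simp: c_def)
    then show False using that by (auto simp: l_def)
  qed
  \<comment> \<open>Stated for any \<open>x\<close> because it is applied both at \<open>l\<close>
    and at n - 2.\<close>
  have neg: "family_poly \<alpha> n b x s < 0"
    if "x - real n + 2 + c * s > 0" "x - \<alpha> * s > 0" "rho_alpha \<alpha> (G_graph n b s) > x" for x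
    using rho_alpha_G_graph_le[of s \<alpha> b n x] that s room[of s] \<alpha> by (force simp: c_def)
  have "?p s < 0" using neg[OF D1 D2 gt] s by simp
  \<comment> \<open>The fourth point \<open>l / \<alpha>\<close> lies to the right of
    \<open>k\<close>.\<close>
  have lead_neg: "family_lead \<alpha> b < 0"
    using family_poly_signs(2)[of 1 s k "l / \<alpha>" \<alpha> n b l] s ends[of 1] ends[of k] \<open>?p s < 0\<close>
      \<open>l / \<alpha> > k\<close> \<open>?p (l / \<alpha>) \<le> 0\<close> by simp
  show False
  proof (cases "l \<le> real n - 2")
    case True
    \<comment> \<open>The zero of the middle factor: l \<le> n - 2 makes it nonnegative, and
      \<open>l_gt\<close> places it to the left of 1.\<close>
    define x0 where "x0 = (real n - 2 - l) / c"
    have x0: "0 \<le> x0" "x0 < 1" "l - real n + 2 + c * x0 = 0"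
      using True c l_gt by (auto simp: x0_def field_simps)
    have "(real b + 1) * x0 \<le> (real b + 1) * 1"
      using x0 by (intro mult_left_mono) auto
    then have "real n - (real b + 1) * x0 - 1 \<ge> 0" using m_pos by linarith
    then have "(1 - \<alpha>)\<^sup>2 * x0 * ((real n - (real b + 1) * x0 - 1) * (l - \<alpha> * x0)) \<ge> 0"
      using x0 D2[of x0] s by (intro mult_nonneg_nonneg) auto
    then have "?p x0 \<le> 0"
      using x0 unfolding family_poly_factored c_def[symmetric] by simp
    then have "family_lead \<alpha> b > 0"
      using family_poly_signs(1)[of x0 1 s k \<alpha> n b l] x0 s ends[of 1] ends[of k] \<open>?p s < 0\<close> by simp
    with lead_neg show False by simp
  next
    case False
    have "family_lead \<alpha> b > 0"
    proof (rule family_lead_pos[OF \<alpha>])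
      show "real b \<ge> 3" "real s \<ge> 2" using b s by auto
      have "(real b + 1) * (real s + 1) \<le> (real b + 1) * k"
        using s by (intro mult_left_mono) auto
      then show "(real b + 1) * (real s + 1) + 2 \<le> n" using nr by linarith
      have "\<alpha> * s \<le> 1 * real s" using \<alpha> by (intro mult_right_mono) auto
      moreover have "real s \<le> real k" using s by simp
      ultimately have "real n - 2 > \<alpha> * s" using n_big bk by linarith
      \<comment> \<open>Since \<rho> at \<open>s\<close> exceeds \<open>l\<close>, it also exceeds n
        - 2, where the middle factor equals c s > 0.\<close>
      then show "family_poly \<alpha> n b (real n - 2) s < 0"
        using neg[of "real n - 2"] gt False c s \<open>real n - 2 > \<alpha> * s\<close> by simp
    qed
    with lead_neg show False by simp
  qed
qed

theorem theorem1p1: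
  fixes n b k :: nat and \<alpha> :: real
  assumes "even n" and "n > 0"
    and "odd b" and "b \<ge> 3"
    and "k = (n - 2) div (b + 1)" and "k \<ge> 1"
    and "1 / 2 < \<alpha>" and "\<alpha> < 1"
  shows "Max ((\<lambda>s. rho_alpha \<alpha> (G_graph n b s)) ` {1..k}) =
         max (rho_alpha \<alpha> (G_graph n b 1)) (rho_alpha \<alpha> (G_graph n b k))"
proof (rule Max_eqI)
  have "(b + 1) * k \<le> n - 2" unfolding assms(5) by (rule times_div_less_eq_dividend)
  \<comment> \<open>Positivity shows that the natural number subtraction n - 2 does not
    truncate.\<close>
  moreover have "(b + 1) * k > 0" using assms(6) by simp
  ultimately have n: "(b + 1) * k + 2 \<le> n" by linarith
  fix y assume "y \<in> (\<lambda>s. rho_alpha \<alpha> (G_graph n b s)) ` {1..k}"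
  then obtain s where s: "1 \<le> s" "s \<le> k" "y = rho_alpha \<alpha> (G_graph n b s)" by auto
  consider "s = 1" | "s = k" | "1 < s" "s < k" using s by linarith
  then show "y \<le> max (rho_alpha \<alpha> (G_graph n b 1)) (rho_alpha \<alpha> (G_graph n b k))"
    unfolding s(3) using rho_alpha_G_graph_le_ends[OF assms(4) n _ _ assms(7,8)] by cases auto
qed (use assms(6) in \<open>auto simp: max_def\<close>)

end
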